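(* Let $G$ be a graph of order $n\ge 2$ such that each of $G$ and its complement $\overline G$ has an edge. Then $$\frac{5n}{4}-2\ \le\ \operatorname{th}_{\operatorname{Z}}^{\ast}(G)+\operatorname{th}_{\operatorname{Z}}^{\ast}(\overline G),$$ and this lower bound is almost sharp even when both $G$ and $\overline G$ are required to be connected.
   Context: Graphs are finite, simple, undirected, with nonempty vertex set; the order of $G$ is $|V(G)|$; $\overline G$ is the complement of $G$. Standard zero forcing: each vertex is filled or unfilled. Color change rule: if $w$ is the unique unfilled neighbor of a filled vertex $v$, then fill $w$. For $B\subseteq V(G)$ put $B^{[0]}=B$, and let $B^{[i+1]}$ be $B^{[i]}$ together with all vertices that can be filled by one application of the rule when exactly the vertices of $B^{[i]}$ are filled. $\operatorname{pt}_{\operatorname{Z}}(G;B)$ is the least $t$ with $B^{[t]}=V(G)$ ($\infty$ if none exists), and $\operatorname{pt}_{\operatorname{Z}}(G,k)=\min_{|B|=k}\operatorname{pt}_{\operatorname{Z}}(G;B)$. For a graph $G$ of order $n$ with at least one edge, the no initial cost product throttling number is $\operatorname{th}_{\operatorname{Z}}^{\ast}(G)=\min_{1\le k\le n-1}k\cdot\operatorname{pt}_{\operatorname{Z}}(G,k)$. A bound $b(n)$ on $\zeta(G)+\zeta(\overline G)$ (where $n$ is the order of $G$) is almost sharp if, for some positive integer $k<10$, infinitely many graphs $G$ (in the class considered) satisfy $\zeta(G)+\zeta(\overline G)=b(n)\pm k$. *)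

theory Defs
  imports
    "Graph_Theory.Graph_Theory"
    "HOL-Library.Extended_Real"
begin

text \<open>
  A finite simple undirected graph is a \<open>pair_graph\<close>: a finite vertex set \<open>pverts G\<close> with a
  symmetric irreflexive adjacency relation \<open>parcs G\<close> on it.
\<close>

definition graph_complement :: "'a pair_pre_digraph \<Rightarrow> 'a pair_pre_digraph" where
  "graph_complement G =
     \<lparr> pverts = pverts G,
       parcs = {(u, v). u \<in> pverts G \<and> v \<in> pverts G \<and> u \<noteq> v \<and> (u, v) \<notin> parcs G} \<rparr>"

definition has_edge :: "'a pair_pre_digraph \<Rightarrow> bool" where
  "has_edge G \<longleftrightarrow> parcs G \<noteq> {}"

definition zf_step :: "'a pair_pre_digraph \<Rightarrow> 'a set \<Rightarrow> 'a set" where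
  "zf_step G B = B \<union> {w. \<exists>v\<in>B. {u. (v, u) \<in> parcs G \<and> u \<notin> B} = {w}}"

definition zf_after :: "'a pair_pre_digraph \<Rightarrow> 'a set \<Rightarrow> nat \<Rightarrow> 'a set" where
  "zf_after G B t = (zf_step G ^^ t) B"

text \<open>Since \<open>Inf {} = \<infinity>\<close> in \<^typ>\<open>enat\<close>, the propagation time is infinite when no \<open>t\<close> works.\<close>

definition prop_time :: "'a pair_pre_digraph \<Rightarrow> 'a set \<Rightarrow> enat" where
  "prop_time G B = Inf (enat ` {t. zf_after G B t = pverts G})"

definition prop_time_card :: "'a pair_pre_digraph \<Rightarrow> nat \<Rightarrow> enat" where
  "prop_time_card G k = (INF B\<in>{B. B \<subseteq> pverts G \<and> card B = k}. prop_time G B)"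

definition throttling_star :: "'a pair_pre_digraph \<Rightarrow> enat" where
  "throttling_star G = (INF k\<in>{1..card (pverts G) - 1}. enat k * prop_time_card G k)"

text \<open>
  ``Infinitely many graphs'' is understood up to isomorphism; otherwise the infinitely many
  relabellings of a single graph would qualify.
\<close>

definition infinitely_many_graphs :: "'a pair_pre_digraph set \<Rightarrow> bool" where
  "infinitely_many_graphs C \<longleftrightarrow>
     (\<exists>S \<subseteq> C. infinite S \<and>
        pairwise (\<lambda>G H. \<not> digraph_iso (with_proj G) (with_proj H)) S)"

definition almost_sharp ::
  "'a pair_pre_digraph set \<Rightarrow> ('a pair_pre_digraph \<Rightarrow> enat) \<Rightarrow> (nat \<Rightarrow> real) \<Rightarrow> bool" where
  "almost_sharp C \<zeta> b \<longleftrightarrow>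
     (\<exists>k::nat. 0 < k \<and> k < 10 \<and>
        infinitely_many_graphs
          {G \<in> C. let s = ereal_of_enat (\<zeta> G + \<zeta> (graph_complement G)); n = card (pverts G)
                  in s = ereal (b n + real k) \<or> s = ereal (b n - real k)})"

end

theory Submission
  imports Defs
begin

text \<open>
  The number of active filled vertices never grows, so at most \<open>card B\<close> vertices are filled per
  step and \<open>n \<le> card B * (t + 1)\<close>. If both propagation times are at least \<open>2\<close>, each product
  is at least \<open>2 * n / 3\<close>. Otherwise, say, \<open>G\<close> is filled in one step from \<open>B\<close>: the \<open>m = n - card B\<close>
  forcing vertices and the \<open>m\<close> unfilled ones are joined by a perfect matching in \<open>G\<close>, so
  they form a nearly complete bipartite pair in the complement. There, forces cannot come from
  one side unless at most two vertices of the other side are unfilled, and this makes the product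
  for the complement at least \<open>n / 4 + m - 2\<close>.
\<close>

section \<open>Basic facts about finite symmetric irreflexive graphs\<close>

lemma pair_graphD:
  assumes "pair_graph G"
  shows "finite (pverts G)" "(u, v) \<in> parcs G \<Longrightarrow> u \<in> pverts G"
    "(u, v) \<in> parcs G \<Longrightarrow> v \<in> pverts G" "(u, v) \<in> parcs G \<Longrightarrow> u \<noteq> v"
    "(u, v) \<in> parcs G \<Longrightarrow> (v, u) \<in> parcs G"
proof -
  interpret pair_graph G by fact
  show "finite (pverts G)" by (rule pair_finite_verts)
  show "(u, v) \<in> parcs G \<Longrightarrow> u \<in> pverts G" "(u, v) \<in> parcs G \<Longrightarrow> v \<in> pverts G"
    by (auto dest: wellformed')
  show "(u, v) \<in> parcs G \<Longrightarrow> u \<noteq> v" using pair_no_loops[of "(u, v)"] by auto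
  show "(u, v) \<in> parcs G \<Longrightarrow> (v, u) \<in> parcs G"
    using pair_sym_arcs by (auto simp: symmetric_def dest: symD)
qed

lemma pair_graphI:
  assumes "finite (pverts G)" "parcs G \<subseteq> pverts G \<times> pverts G"
    "\<And>u v. (u, v) \<in> parcs G \<Longrightarrow> u \<noteq> v \<and> (v, u) \<in> parcs G"
  shows "pair_graph G"
proof
  show "finite (parcs G)" using assms(1,2) by (meson finite_SigmaI finite_subset)
  show "symmetric (with_proj G)" using assms(3) by (auto simp: symmetric_def intro: symI)
qed (use assms in auto)

section \<open>Propagation\<close>

lemma zf_step_superset: "B \<subseteq> zf_step G B"
  by (auto simp: zf_step_def)

lemma zf_step_subset:
  assumes "pair_graph G" "B \<subseteq> pverts G"
  shows "zf_step G B \<subseteq> pverts G"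
  using assms(2) pair_graphD(3)[OF assms(1)] unfolding zf_step_def by blast

lemma zf_after_0 [simp]: "zf_after G B 0 = B"
  by (simp add: zf_after_def)

lemma zf_after_Suc [simp]: "zf_after G B (Suc t) = zf_step G (zf_after G B t)"
  by (simp add: zf_after_def)

lemma zf_after_subset:
  assumes "pair_graph G" "B \<subseteq> pverts G"
  shows "zf_after G B t \<subseteq> pverts G"
  by (induction t) (simp_all add: assms zf_step_subset)

text \<open>Choose one forcer per newly filled vertex. A forcer has a single unfilled neighbour, so
  it determines the vertex it fills; counting filled vertices becomes counting forcers.\<close>

lemma zf_forcers:
  fixes G :: "'a pair_pre_digraph" and S :: "'a set"
  obtains h where "inj_on h (zf_step G S - S)"
    and "\<And>w. w \<in> zf_step G S - S \<Longrightarrow> h w \<in> S \<and> {u. (h w, u) \<in> parcs G \<and> u \<notin> S} = {w}"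
proof -
  have "\<forall>w\<in>zf_step G S - S. \<exists>v\<in>S. {u. (v, u) \<in> parcs G \<and> u \<notin> S} = {w}"
    by (auto simp: zf_step_def)
  then have "\<exists>h. \<forall>w\<in>zf_step G S - S. h w \<in> S \<and> {u. (h w, u) \<in> parcs G \<and> u \<notin> S} = {w}"
    by (intro bchoice) (simp only: Bex_def)
  then obtain h
    where h: "\<And>w. w \<in> zf_step G S - S \<Longrightarrow> h w \<in> S \<and> {u. (h w, u) \<in> parcs G \<and> u \<notin> S} = {w}"
    by blast
  have "inj_on h (zf_step G S - S)"
  proof (rule inj_onI)
    fix x y assume xy: "x \<in> zf_step G S - S" "y \<in> zf_step G S - S" "h x = h y"
    have "{x} = {u. (h x, u) \<in> parcs G \<and> u \<notin> S}"
      using h[OF xy(1)] by (rule conjunct2[THEN sym])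
    also have "\<dots> = {y}"
      unfolding xy(3) using h[OF xy(2)] by (rule conjunct2)
    finally show "x = y" by simp
  qed
  then show thesis using h by (rule that)
qed

text \<open>Only active vertices can force, and as the filled set only grows, a filled vertex that
  is inactive stays so. Their number is the quantity that never increases.\<close>

definition active :: "'a pair_pre_digraph \<Rightarrow> 'a set \<Rightarrow> 'a set" where
  "active G S = {v \<in> S. \<exists>u. (v, u) \<in> parcs G \<and> u \<notin> S}"

lemma card_zf_step_diff_le_active:
  assumes "finite S"
  shows "card (zf_step G S - S) \<le> card (active G S)"
proof -
  obtain h where h: "inj_on h (zf_step G S - S)"
    "\<And>w. w \<in> zf_step G S - S \<Longrightarrow> h w \<in> S \<and> {u. (h w, u) \<in> parcs G \<and> u \<notin> S} = {w}"
    by (rule zf_forcers, rule that) blast+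
  have "h ` (zf_step G S - S) \<subseteq> active G S"
    using h(2) unfolding active_def by blast
  then show ?thesis
    using h(1) assms by (intro card_inj_on_le) (auto simp: active_def)
qed

text \<open>A vertex that forces becomes inactive, so each newly filled vertex replaces an active one.\<close>

lemma card_active_zf_step_le:
  assumes "finite S" "finite (zf_step G S)"
  shows "card (active G (zf_step G S)) \<le> card (active G S)"
proof -
  let ?N = "zf_step G S - S"
  obtain h where h: "inj_on h ?N"
    "\<And>w. w \<in> ?N \<Longrightarrow> h w \<in> S \<and> {u. (h w, u) \<in> parcs G \<and> u \<notin> S} = {w}"
    by (rule zf_forcers, rule that) blast+
  have fin: "finite (active G S)" using assms(1) by (simp add: active_def)
  have sub: "h ` ?N \<subseteq> active G S"
    using h(2) unfolding active_def by blast
  have "active G (zf_step G S) \<subseteq> (active G S - h ` ?N) \<union> ?N"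
  proof
    fix v assume "v \<in> active G (zf_step G S)"
    then obtain u where u: "v \<in> zf_step G S" "(v, u) \<in> parcs G" "u \<notin> zf_step G S"
      by (auto simp: active_def)
    moreover have "u \<notin> S" using u(3) zf_step_superset[of S G] by blast
    moreover have "v \<notin> h ` ?N"
    proof
      assume "v \<in> h ` ?N"
      then obtain w where w: "w \<in> ?N" "v = h w" by blast
      then have "u \<in> {w}" using h(2)[OF w(1)] u(2) \<open>u \<notin> S\<close> by blast
      then show False using u(3) w(1) by blast
    qed
    ultimately show "v \<in> (active G S - h ` ?N) \<union> ?N"
      by (auto simp: active_def)
  qed
  then have "card (active G (zf_step G S)) \<le> card ((active G S - h ` ?N) \<union> ?N)"
    using fin assms(2) by (intro card_mono) auto
  also have "\<dots> \<le> card (active G S - h ` ?N) + card ?N"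
    by (rule card_Un_le)
  also have "card (active G S - h ` ?N) = card (active G S) - card ?N"
    using sub fin h(1) by (simp add: card_Diff_subset finite_subset card_image)
  also have "card (active G S) - card ?N + card ?N = card (active G S)"
    using card_zf_step_diff_le_active[OF assms(1), of G] by simp
  finally show ?thesis .
qed

context
  fixes G :: "'a pair_pre_digraph" and B :: "'a set"
  assumes G: "pair_graph G" and B: "B \<subseteq> pverts G"
begin

lemma finite_zf_after: "finite (zf_after G B t)"
  using zf_after_subset[OF G B] pair_graphD(1)[OF G] by (rule finite_subset)

lemma card_active_zf_after_le: "card (active G (zf_after G B t)) \<le> card B"
proof (induction t)
  case 0
  show ?case using finite_zf_after[of 0] by (auto simp: active_def intro: card_mono)
next
  case (Suc t)
  then show ?case
    using card_active_zf_step_le[OF finite_zf_after[of t], of G] finite_zf_after[of "Suc t"] by simp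
qed

text \<open>Every single round is bounded, not only the total; \<open>nearly_joined_cost\<close>
  relies on this when \<open>t = 2\<close>.\<close>

lemma card_zf_after_Suc_diff_le: "card (zf_after G B (Suc t) - zf_after G B t) \<le> card B"
  using card_zf_step_diff_le_active[OF finite_zf_after[of t], of G] card_active_zf_after_le[of t]
  by simp

lemma card_zf_after_Suc:
  "card (zf_after G B (Suc t)) =
     card (zf_after G B t) + card (zf_after G B (Suc t) - zf_after G B t)"
proof -
  have "zf_after G B t \<subseteq> zf_after G B (Suc t)"
    by (simp add: zf_step_superset)
  then show ?thesis
    using finite_zf_after[of t] card_mono[OF finite_zf_after[of "Suc t"], of "zf_after G B t"]
    by (simp only: card_Diff_subset le_add_diff_inverse)
qed

lemma card_zf_after_le: "card (zf_after G B t) \<le> card B * Suc t"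
proof (induction t)
  case (Suc t)
  then show ?case
    using card_zf_after_Suc[of t] card_zf_after_Suc_diff_le[of t] by simp
qed simp

end

section \<open>Product throttling\<close>

lemma throttling_star_le:
  assumes "B \<subseteq> pverts G" "1 \<le> card B" "card B < card (pverts G)" "zf_after G B t = pverts G"
  shows "throttling_star G \<le> enat (card B * t)"
proof -
  have "prop_time G B \<le> enat t"
    unfolding prop_time_def using assms(4) by (intro Inf_lower) auto
  then have "prop_time_card G (card B) \<le> enat t"
    unfolding prop_time_card_def using assms(1) by (intro INF_lower2[of B]) auto
  then have "enat (card B) * prop_time_card G (card B) \<le> enat (card B) * enat t"
    by (rule mult_left_mono) simp
  moreover have "throttling_star G \<le> enat (card B) * prop_time_card G (card B)"
    unfolding throttling_star_def using assms by (intro INF_lower) auto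
  ultimately show ?thesis by simp
qed

text \<open>\<open>enat\<close> is well-ordered, so the infimum of a nonempty family is a least
  element; a finite value excludes the empty family.\<close>

lemma enat_INF_attained:
  fixes f :: "'a \<Rightarrow> enat"
  assumes "(INF x\<in>A. f x) \<noteq> \<infinity>"
  shows "\<exists>x\<in>A. (INF x\<in>A. f x) = f x"
proof -
  have "A \<noteq> {}" using assms by (auto simp: top_enat_def)
  then have "Inf (f ` A) \<in> f ` A"
    by (simp add: Inf_enat_def) (metis LeastI_ex ex_in_conv imageI)
  then show ?thesis by blast
qed

lemma throttling_star_attained:
  assumes "throttling_star G \<noteq> \<infinity>"
  obtains B t where "B \<subseteq> pverts G" "1 \<le> card B" "card B < card (pverts G)" "0 < t"
    "zf_after G B t = pverts G" "throttling_star G = enat (card B * t)"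
proof -
  obtain k where k: "k \<in> {1..card (pverts G) - 1}"
    and th: "throttling_star G = enat k * prop_time_card G k"
    using enat_INF_attained[OF assms[unfolded throttling_star_def]]
    unfolding throttling_star_def by blast
  \<comment> \<open>Since \<open>k\<close> is at least \<open>1\<close>, an infinite factor would
    make the product infinite.\<close>
  have "prop_time_card G k \<noteq> \<infinity>"
    using assms k th by (auto simp: imult_is_infinity zero_enat_def)
  from enat_INF_attained[OF this[unfolded prop_time_card_def]]
  obtain B where B: "B \<subseteq> pverts G" "card B = k" and eq: "prop_time_card G k = prop_time G B"
    unfolding prop_time_card_def by blast
  have "prop_time G B \<noteq> \<infinity>"
    using \<open>prop_time_card G k \<noteq> \<infinity>\<close> eq by simp
  from enat_INF_attained[OF this[unfolded prop_time_def]]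
  obtain t where t: "zf_after G B t = pverts G" "prop_time G B = enat t"
    unfolding prop_time_def by blast
  have "card B < card (pverts G)" using k B by auto
  \<comment> \<open>Some vertex is initially unfilled, which rules out time \<open>0\<close>; the
    later case distinctions on the time start at \<open>1\<close>.\<close>
  moreover from this have "0 < t" using t(1) by (cases t) auto
  moreover have "1 \<le> card B" using k B by auto
  ultimately show thesis
    using that[of B t] B t th eq by simp
qed

section \<open>Graphs filled in one step and their complements\<close>

lemma pverts_graph_complement [simp]: "pverts (graph_complement G) = pverts G"
  by (simp add: graph_complement_def)

lemma parcs_graph_complement_iff [simp]:
  "(u, v) \<in> parcs (graph_complement G) \<longleftrightarrow>
     u \<in> pverts G \<and> v \<in> pverts G \<and> u \<noteq> v \<and> (u, v) \<notin> parcs G"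
  by (simp add: graph_complement_def)

lemma pair_graph_complement:
  assumes "pair_graph G"
  shows "pair_graph (graph_complement G)"
  by (rule pair_graphI) (use pair_graphD[OF assms] in auto)

lemma graph_complement_complement:
  assumes "pair_graph G"
  shows "graph_complement (graph_complement G) = G"
  by (rule pair_pre_digraph.equality) (use pair_graphD[OF assms] in auto)

text \<open>A complete bipartite pair up to a partial matching. The exceptional \<open>q\<close> and
  \<open>p\<close> may lie outside \<open>Q\<close> and \<open>P\<close>, which covers vertices
  joined to the whole other side.\<close>

definition nearly_joined :: "'a pair_pre_digraph \<Rightarrow> 'a set \<Rightarrow> 'a set \<Rightarrow> bool" where
  "nearly_joined H P Q \<longleftrightarrow>
     (\<forall>x\<in>P. \<exists>q. \<forall>y\<in>Q. y \<noteq> q \<longrightarrow> (x, y) \<in> parcs H) \<and>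
     (\<forall>y\<in>Q. \<exists>p. \<forall>x\<in>P. x \<noteq> p \<longrightarrow> (x, y) \<in> parcs H)"

lemma nearly_joined_sym:
  assumes "pair_graph H" "nearly_joined H P Q"
  shows "nearly_joined H Q P"
  using assms(2) pair_graphD(5)[OF assms(1)] unfolding nearly_joined_def by meson

section \<open>Forcing across a nearly joined pair\<close>

context
  fixes H :: "'a pair_pre_digraph" and S :: "'a set" and h :: "'a \<Rightarrow> 'a"
  assumes h: "\<And>w. w \<in> zf_step H S - S \<Longrightarrow> h w \<in> S \<and> {u. (h w, u) \<in> parcs H \<and> u \<notin> S} = {w}"
begin

text \<open>A forcer in \<open>P\<close> sees all of \<open>Q\<close> except perhaps
  \<open>q\<close>, yet its only unfilled neighbour is the vertex \<open>w\<close> it forces. So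
  only \<open>q\<close> and \<open>w\<close> can be unfilled in \<open>Q\<close>.\<close>

lemma card_unfilled_le_2:
  assumes "nearly_joined H P Q" "h ` (zf_step H S - S) \<inter> P \<noteq> {}"
  shows "card (Q - S) \<le> 2"
proof -
  obtain w where w: "w \<in> zf_step H S - S" "h w \<in> P"
    using assms(2) by auto
  then obtain q where "\<forall>y\<in>Q. y \<noteq> q \<longrightarrow> (h w, y) \<in> parcs H"
    using assms(1) unfolding nearly_joined_def by meson
  then have "Q - S \<subseteq> {q, w}"
    using h[OF w(1)] by auto
  then have "card (Q - S) \<le> card {q, w}"
    by (intro card_mono) auto
  also have "\<dots> \<le> 2" by (simp add: card_insert_if)
  finally show ?thesis .
qed

text \<open>An unfilled \<open>y\<close> in \<open>Q\<close> is seen by all of \<open>P\<close>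
  except perhaps \<open>p\<close>, so a forcer in \<open>P\<close> other than \<open>p\<close> must
  force \<open>y\<close> and is therefore \<open>h y\<close>.\<close>

lemma card_forcers_le_2:
  assumes "nearly_joined H P Q" "\<not> Q \<subseteq> S"
  shows "card (h ` (zf_step H S - S) \<inter> P) \<le> 2"
proof -
  obtain y where y: "y \<in> Q" "y \<notin> S" using assms(2) by auto
  then obtain p where p: "\<forall>x\<in>P. x \<noteq> p \<longrightarrow> (x, y) \<in> parcs H"
    using assms(1) unfolding nearly_joined_def by meson
  have "h ` (zf_step H S - S) \<inter> P \<subseteq> {p, h y}"
  proof
    fix x assume x: "x \<in> h ` (zf_step H S - S) \<inter> P"
    then obtain w where w: "w \<in> zf_step H S - S" "x = h w" by blast
    show "x \<in> {p, h y}"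
    proof (cases "x = p")
      case False
      then have "y \<in> {u. (h w, u) \<in> parcs H \<and> u \<notin> S}"
        using p x y(2) w(2) by simp
      then show ?thesis using h[OF w(1)] w(2) by simp
    qed simp
  qed
  then have "card (h ` (zf_step H S - S) \<inter> P) \<le> card {p, h y}"
    by (intro card_mono) auto
  also have "\<dots> \<le> 2" by (simp add: card_insert_if)
  finally show ?thesis .
qed

text \<open>If \<open>Q\<close> is filled, the forcers lie in \<open>S - Q\<close>. Otherwise at
  most two lie in \<open>P\<close>, and the others lie outside both \<open>P\<close> and
  \<open>Q\<close>.\<close>

lemma one_sided_forcers:
  assumes fin: "finite V" and V: "P \<subseteq> V" "Q \<subseteq> V" "S \<subseteq> V" and disj: "P \<inter> Q = {}"
    and cards: "card P = m" "card Q = m" and join: "nearly_joined H P Q"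
    and inj: "inj_on h (zf_step H S - S)" and none: "h ` (zf_step H S - S) \<inter> Q = {}"
  shows "card (zf_step H S - S) + 2 * m \<le> card V + 2 \<or> card (zf_step H S - S) + m \<le> card S"
proof -
  let ?F = "h ` (zf_step H S - S)"
  have F: "?F \<subseteq> S" using h by blast
  have card_F: "card ?F = card (zf_step H S - S)" using inj by (rule card_image)
  have finS: "finite S" using fin V(3) by (rule finite_subset[rotated])
  show ?thesis
  proof (cases "Q \<subseteq> S")
    case True
    have "card ?F \<le> card (S - Q)" using F none finS by (intro card_mono) auto
    also have "\<dots> = card S - m"
      using True finS cards by (simp add: card_Diff_subset finite_subset)
    finally show ?thesis
      using card_F card_mono[OF finS True] cards by linarith
  next
    case False
    have "card ?F \<le> card ((V - (P \<union> Q)) \<union> (?F \<inter> P))"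
      using F V none fin by (intro card_mono) (auto simp: finite_subset)
    also have "\<dots> \<le> card (V - (P \<union> Q)) + card (?F \<inter> P)" by (rule card_Un_le)
    also have "\<dots> \<le> card (V - (P \<union> Q)) + 2"
      using card_forcers_le_2[OF join False] by simp
    also have "card (V - (P \<union> Q)) = card V - 2 * m"
      using fin V cards disj by (simp add: card_Diff_subset finite_subset card_Un_disjoint)
    finally have "card ?F \<le> card V - 2 * m + 2" .
    moreover have "2 * m \<le> card V"
      using card_mono[OF fin, of "P \<union> Q"] V fin cards disj
      by (simp add: card_Un_disjoint finite_subset)
    ultimately show ?thesis using card_F by linarith
  qed
qed

end

text \<open>If the forcers avoid \<open>P\<close> or \<open>Q\<close>, they are few by
  \<open>one_sided_forcers\<close>. If they meet both, each side has at most two unfilled vertices,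
  whence the \<open>4\<close>.\<close>

lemma nearly_joined_step:
  assumes H: "pair_graph H" and V: "P \<subseteq> pverts H" "Q \<subseteq> pverts H" "S \<subseteq> pverts H"
    and disj: "P \<inter> Q = {}" and cards: "card P = m" "card Q = m" and join: "nearly_joined H P Q"
  shows "card (zf_step H S - S) + 2 * m \<le> card (pverts H) + 2 \<or>
    card (zf_step H S - S) + m \<le> card S \<or> 2 * m \<le> card S + 4"
proof -
  obtain h where inj: "inj_on h (zf_step H S - S)"
    and h: "\<And>w. w \<in> zf_step H S - S \<Longrightarrow> h w \<in> S \<and> {u. (h w, u) \<in> parcs H \<and> u \<notin> S} = {w}"
    by (rule zf_forcers, rule that) blast+
  have fin: "finite (pverts H)" by (rule pair_graphD[OF H])
  note join' = nearly_joined_sym[OF H join]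
  consider "h ` (zf_step H S - S) \<inter> Q = {}" | "h ` (zf_step H S - S) \<inter> P = {}"
    | "h ` (zf_step H S - S) \<inter> P \<noteq> {}" "h ` (zf_step H S - S) \<inter> Q \<noteq> {}" by blast
  then show ?thesis
  proof cases
    case 1
    then show ?thesis
      using one_sided_forcers[OF h fin V disj cards join inj] by blast
  next
    case 2
    then show ?thesis
      using one_sided_forcers[OF h fin V(2,1,3) _ cards(2,1) join' inj] disj by blast
  next
    case 3
    have "card (P - S) \<le> 2" "card (Q - S) \<le> 2"
      using card_unfilled_le_2[OF h join'] card_unfilled_le_2[OF h join] 3 by auto
    moreover have "2 * m = card (P \<union> Q)"
      using V fin disj cards by (simp add: card_Un_disjoint finite_subset)
    moreover have "card (P \<union> Q) \<le> card (S \<union> (P - S) \<union> (Q - S))"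
      using V fin by (intro card_mono) (auto simp: finite_subset)
    moreover have "\<dots> \<le> card S + card (P - S) + card (Q - S)"
      by (meson add_le_mono1 card_Un_le order_trans)
    ultimately show ?thesis by linarith
  qed
qed

text \<open>Take \<open>P\<close> to be the set of forcers. In \<open>G\<close> the forcer of
  \<open>w\<close> has no neighbour outside \<open>B\<close> but \<open>w\<close>, so in the
  complement it sees every other vertex outside \<open>B\<close>.\<close>

lemma one_step_nearly_joined:
  assumes G: "pair_graph G" and B: "B \<subseteq> pverts G" and full: "zf_step G B = pverts G"
  obtains P where "P \<subseteq> B" "card P = card (pverts G - B)"
    "nearly_joined (graph_complement G) P (pverts G - B)"
proof -
  let ?W = "pverts G - B"
  obtain h where inj: "inj_on h ?W"
    and h: "\<And>w. w \<in> ?W \<Longrightarrow> h w \<in> B \<and> {u. (h w, u) \<in> parcs G \<and> u \<notin> B} = {w}"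
    by (rule zf_forcers[of G B, unfolded full], rule that) blast+
  have adj: "(h w, y) \<in> parcs (graph_complement G)" if "w \<in> ?W" "y \<in> ?W" "y \<noteq> w" for w y
    using h[OF that(1)] that B by auto
  have "nearly_joined (graph_complement G) (h ` ?W) ?W"
    unfolding nearly_joined_def using adj by blast
  moreover have "h ` ?W \<subseteq> B" using h by blast
  ultimately show thesis using that inj by (simp add: card_image)
qed

section \<open>Lower bounds on the cost of filling\<close>

lemma card_full:
  assumes "pair_graph G" "B \<subseteq> pverts G" "zf_after G B t = pverts G"
  shows "card (pverts G) \<le> card B * Suc t"
  using card_zf_after_le[OF assms(1,2), of t] assms(3) by simp

text \<open>The first bound, \<open>n / 4 + m - 2\<close>, serves the general inequality. The second
  has no additive loss when \<open>P\<close> and \<open>Q\<close> cover all vertices, and gives the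
  exact value for the sharp family.\<close>

lemma nearly_joined_cost:
  assumes H: "pair_graph H" and V: "P \<subseteq> pverts H" "Q \<subseteq> pverts H" and disj: "P \<inter> Q = {}"
    and cards: "card P = m" "card Q = m" and join: "nearly_joined H P Q"
    and B: "B \<subseteq> pverts H" "zf_after H B t = pverts H" and t: "0 < t"
  shows "card (pverts H) + 4 * m \<le> 4 * (card B * t) + 8"
    and "card (pverts H) = 2 * m \<Longrightarrow> 8 \<le> m \<Longrightarrow> 3 * card (pverts H) \<le> 4 * (card B * t)"
proof -
  define n where "n = card (pverts H)"
  have fin: "finite (pverts H)" by (rule pair_graphD[OF H])
  have "card (P \<union> Q) \<le> n"
    unfolding n_def using V fin by (intro card_mono) auto
  then have m: "2 * m \<le> n"
    using V fin disj cards by (simp add: card_Un_disjoint finite_subset)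
  have full: "n \<le> card B * Suc t"
    using card_full[OF H B] by (simp add: n_def)
  have step: "card (zf_step H S - S) + 2 * m \<le> n + 2 \<or>
      card (zf_step H S - S) + m \<le> card S \<or> 2 * m \<le> card S + 4" if "S \<subseteq> pverts H" for S
    using nearly_joined_step[OF H V that disj cards join] by (simp add: n_def)
  note card_Suc = card_zf_after_Suc[OF H B(1)] and diff_le = card_zf_after_Suc_diff_le[OF H B(1)]
  have "t = 1 \<or> t = 2 \<or> 3 \<le> t" using t by linarith
  then consider "t = 1" | "t = 2" | "3 \<le> t" by blast
  then have "n + 4 * m \<le> 4 * (card B * t) + 8 \<and>
      (n = 2 * m \<longrightarrow> 8 \<le> m \<longrightarrow> 3 * n \<le> 4 * (card B * t))"
  proof cases
    case 1
    then have "n = card B + card (zf_step H B - B)"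
      using card_Suc[of 0] B(2) by (simp add: n_def)
    \<comment> \<open>With \<open>b = card B\<close>, the alternatives give
      \<open>b >= 2 * m - 2\<close>, \<open>2 * b >= n + m\<close> or \<open>b >= 2 * m - 4\<close>,
      to be combined with \<open>n <= 2 * b\<close>. The last one dictates both the constant
      \<open>8\<close> and the condition \<open>8 <= m\<close>.\<close>
    then show ?thesis using step[OF B(1)] full m 1 by auto
  next
    case 2
    let ?S = "zf_step H B"
    have "card ?S = card B + card (?S - B)" using card_Suc[of 0] by simp
    moreover have "n = card ?S + card (zf_step H ?S - ?S)"
      using card_Suc[of 1] B(2) 2 by (simp add: n_def numeral_2_eq_2)
    moreover have "card (zf_step H ?S - ?S) \<le> card B" "card (?S - B) \<le> card B"
      using diff_le[of 1] diff_le[of 0] by simp_all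
    \<comment> \<open>The cost is now \<open>2 * b\<close> and \<open>n <= 3 * b\<close>. The
      alternatives for the first round give \<open>b >= m - 1\<close> (as the second round fills at
      most \<open>b\<close>), \<open>3 * b >= n + m\<close> or
      \<open>b >= 2 * m - 4\<close>.\<close>
    ultimately show ?thesis
      using step[OF B(1)] step[OF zf_step_subset[OF H B(1)]] full m 2 by auto
  next
    case 3
    then have "card B * 3 \<le> card B * t" by (rule mult_le_mono2)
    \<comment> \<open>For three or more rounds the general count suffices: \<open>b\<close> is at
      most a third of \<open>b * t\<close>.\<close>
    then have "3 * n \<le> 4 * (card B * t)" using full unfolding mult_Suc_right by linarith
    moreover have "n + 4 * m \<le> 3 * n" using m by simp
    ultimately show ?thesis by linarith
  qed
  then show "card (pverts H) + 4 * m \<le> 4 * (card B * t) + 8"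
    and "card (pverts H) = 2 * m \<Longrightarrow> 8 \<le> m \<Longrightarrow> 3 * card (pverts H) \<le> 4 * (card B * t)"
    by (simp_all add: n_def)
qed

text \<open>With \<open>m = n - card B\<close>, the graph costs \<open>n - m\<close> and the
  complement at least \<open>n / 4 + m - 2\<close>; in the sum \<open>m\<close> cancels.\<close>

lemma one_step_complement_bound:
  assumes G: "pair_graph G" and B: "B \<subseteq> pverts G" "zf_after G B 1 = pverts G"
    and B': "B' \<subseteq> pverts G" "zf_after (graph_complement G) B' t = pverts G" and t: "0 < t"
  shows "5 * card (pverts G) \<le> 4 * (card B + card B' * t) + 8"
proof -
  let ?H = "graph_complement G"
  obtain P where P: "P \<subseteq> B" "card P = card (pverts G - B)" "nearly_joined ?H P (pverts G - B)"
    using one_step_nearly_joined[OF G B(1)] B(2) by auto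
  have "card (pverts G) + 4 * card (pverts G - B) \<le> 4 * (card B' * t) + 8"
    using nearly_joined_cost(1)[OF pair_graph_complement[OF G], of P "pverts G - B" _ B' t]
      P B(1) B' t by auto
  moreover have "card (pverts G) = card B + card (pverts G - B)"
    using pair_graphD(1)[OF G] B(1) by (simp add: card_Diff_subset finite_subset card_mono)
  ultimately show ?thesis by simp
qed

lemma complement_bound:
  assumes G: "pair_graph G" and B: "B \<subseteq> pverts G" "zf_after G B s = pverts G" and s: "0 < s"
    and B': "B' \<subseteq> pverts G" "zf_after (graph_complement G) B' t = pverts G" and t: "0 < t"
  shows "5 * card (pverts G) \<le> 4 * (card B * s + card B' * t) + 8"
proof -
  have H: "pair_graph (graph_complement G)" using G by (rule pair_graph_complement)
  have "s = 1 \<or> t = 1 \<or> 2 \<le> s \<and> 2 \<le> t" using s t by linarith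
  then consider "s = 1" | "t = 1" | "2 \<le> s" "2 \<le> t" by blast
  then show ?thesis
  proof cases
    case 1
    then show ?thesis using one_step_complement_bound[OF G B(1) _ B' t] B(2) by simp
  next
    case 2
    then show ?thesis
      using one_step_complement_bound[OF H, of B' B s] B B' s
      by (simp add: graph_complement_complement[OF G] add.commute)
  next
    case 3
    have "card B * 2 \<le> card B * s" "card B' * 2 \<le> card B' * t"
      using 3 by (auto intro: mult_le_mono2 simp del: mult_le_cancel1 mult_le_cancel2)
    \<comment> \<open>As \<open>card B\<close> is at most half of \<open>card B * s\<close>, each
      product is at least \<open>2 * n / 3\<close>, and \<open>4 / 3\<close> exceeds
      \<open>5 / 4\<close>.\<close>
    then have "2 * card (pverts G) \<le> 3 * (card B * s)" "2 * card (pverts G) \<le> 3 * (card B' * t)"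
      using card_full[OF G B] card_full[OF H, unfolded pverts_graph_complement, OF B']
      unfolding mult_Suc_right by linarith+
    then show ?thesis by simp
  qed
qed

lemma throttling_star_complement_bound:
  assumes G: "pair_graph G"
  shows "ereal (5 * real (card (pverts G)) / 4 - 2)
    \<le> ereal_of_enat (throttling_star G + throttling_star (graph_complement G))"
proof (cases "throttling_star G = \<infinity> \<or> throttling_star (graph_complement G) = \<infinity>")
  case True
  then show ?thesis by auto
next
  case False
  then obtain B s where B: "B \<subseteq> pverts G" "0 < s" "zf_after G B s = pverts G"
    and thB: "throttling_star G = enat (card B * s)"
    by (meson throttling_star_attained)
  from False obtain B' t where B': "B' \<subseteq> pverts (graph_complement G)" "0 < t"
    "zf_after (graph_complement G) B' t = pverts (graph_complement G)"
    and thB': "throttling_star (graph_complement G) = enat (card B' * t)"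
    by (meson throttling_star_attained)
  have "5 * card (pverts G) \<le> 4 * (card B * s + card B' * t) + 8"
    using complement_bound[OF G B(1,3,2), of B' t] B' by simp
  then have "5 * real (card (pverts G)) \<le> 4 * real (card B * s + card B' * t) + 8"
    by linarith
  then show ?thesis by (simp add: thB thB')
qed

section \<open>A sharp family\<close>

lemma pair_graph_connectedI:
  assumes G: "pair_graph G" and r: "r \<in> pverts G"
    and reach: "\<And>v. v \<in> pverts G \<Longrightarrow> (v, r) \<in> (parcs G)\<^sup>*"
  shows "Digraph_Component.connected (with_proj G)"
proof -
  interpret pair_graph G by fact
  \<comment> \<open>\<open>connected\<close> means strong connectivity of the symmetric closure,
    which here is the graph itself.\<close>
  have "mk_symmetric (with_proj G) = G"
    by (rule pair_pre_digraph.equality)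
      (use pair_graphD(5)[OF G] in \<open>auto simp: parcs_mk_symmetric\<close>)
  moreover have to_r: "v \<rightarrow>\<^sup>*\<^bsub>with_proj G\<^esub> r" if "v \<in> pverts G" for v
    using reach[OF that] reachable_conv'[of v r] that by simp
  have "u \<rightarrow>\<^sup>*\<^bsub>with_proj G\<^esub> v" if "u \<in> pverts G" "v \<in> pverts G" for u v
    using to_r[OF that(1)] symmetric_reachable'[OF to_r[OF that(2)]] by (rule reachable_trans)
  ultimately show ?thesis
    using r by (auto simp: Digraph_Component.connected_def strongly_connected_def)
qed

text \<open>
  A cocktail party graph on \<open>{..<2 * r}\<close>, whose non-edges are the pairs \<open>{i, i + r}\<close>, with a
  pendant vertex \<open>i + 2 * r\<close> attached to each \<open>i\<close>.
\<close>

definition sharp_graph :: "nat \<Rightarrow> nat pair_pre_digraph" where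
  "sharp_graph r =
     \<lparr> pverts = {..<4 * r},
       parcs = {(a, b). a < 4 * r \<and> b < 4 * r \<and>
         (a < 2 * r \<and> b < 2 * r \<and> a mod r \<noteq> b mod r \<or> b = a + 2 * r \<or> a = b + 2 * r)} \<rparr>"

lemma pverts_sharp_graph [simp]: "pverts (sharp_graph r) = {..<4 * r}"
  by (simp add: sharp_graph_def)

lemma parcs_sharp_graph_iff [simp]:
  "(a, b) \<in> parcs (sharp_graph r) \<longleftrightarrow> a < 4 * r \<and> b < 4 * r \<and>
     (a < 2 * r \<and> b < 2 * r \<and> a mod r \<noteq> b mod r \<or> b = a + 2 * r \<or> a = b + 2 * r)"
  by (simp add: sharp_graph_def)

lemma pair_graph_sharp_graph: "pair_graph (sharp_graph r)"
  by (rule pair_graphI) auto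

lemma connected_sharp_graph:
  assumes "2 \<le> r"
  shows "Digraph_Component.connected (with_proj (sharp_graph r))"
proof (rule pair_graph_connectedI[OF pair_graph_sharp_graph])
  let ?E = "parcs (sharp_graph r)"
  show "0 \<in> pverts (sharp_graph r)" using assms by simp
  have 1: "(1, 0) \<in> ?E" using assms by simp
  \<comment> \<open>Within the cocktail party graph, \<open>0\<close> and its only non-neighbour
    \<open>r\<close> are routed through \<open>1\<close>.\<close>
  have core: "(v, 0) \<in> ?E\<^sup>*" if "v < 2 * r" for v
  proof (cases "v mod r = 0")
    case True
    then have "(v, 1) \<in> ?E" using that assms by simp
    then show ?thesis using 1 by (meson converse_rtrancl_into_rtrancl r_into_rtrancl)
  next
    case False
    then have "(v, 0) \<in> ?E" using that by simp
    then show ?thesis by blast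
  qed
  fix v assume "v \<in> pverts (sharp_graph r)"
  then have "v < 2 * r \<or> (v, v - 2 * r) \<in> ?E \<and> v - 2 * r < 2 * r" by auto
  then show "(v, 0) \<in> ?E\<^sup>*"
    using core by (meson converse_rtrancl_into_rtrancl)
qed

lemma connected_complement_sharp_graph:
  assumes "2 \<le> r"
  shows "Digraph_Component.connected (with_proj (graph_complement (sharp_graph r)))"
proof (rule pair_graph_connectedI[OF pair_graph_complement[OF pair_graph_sharp_graph]])
  let ?E = "parcs (graph_complement (sharp_graph r))"
  show "2 * r \<in> pverts (graph_complement (sharp_graph r))" using assms by simp
  fix v assume "v \<in> pverts (graph_complement (sharp_graph r))"
  \<comment> \<open>In the complement the pendant vertex \<open>2 * r\<close> misses only
    \<open>0\<close>, which is then linked through another pendant vertex.\<close>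
  then consider "v = 0" | "v = 2 * r" | "(v, 2 * r) \<in> ?E"
    using assms by fastforce
  then show "(v, 2 * r) \<in> ?E\<^sup>*"
  proof cases
    case 1
    have "(0, 2 * r + 1) \<in> ?E" "(2 * r + 1, 2 * r) \<in> ?E" using assms by simp_all
    then show ?thesis using 1 by (meson converse_rtrancl_into_rtrancl r_into_rtrancl)
  qed auto
qed

text \<open>The core forces all pendant vertices at once. Conversely
  \<open>4 * r <= b + b * t <= 2 * b * t\<close> for every filling set of size \<open>b\<close> and
  time \<open>t >= 1\<close>.\<close>

lemma throttling_star_sharp_graph:
  assumes "0 < r"
  shows "throttling_star (sharp_graph r) = enat (2 * r)"
proof (rule antisym)
  let ?G = "sharp_graph r"
  have "zf_step ?G {..<2 * r} = {..<4 * r}"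
  proof
    show "zf_step ?G {..<2 * r} \<subseteq> {..<4 * r}"
      using zf_step_subset[OF pair_graph_sharp_graph, of "{..<2 * r}" r] by auto
    have "{u. (w - 2 * r, u) \<in> parcs ?G \<and> u \<notin> {..<2 * r}} = {w}"
      if "w \<in> {2 * r..<4 * r}" for w
      using that by auto
    moreover have "w - 2 * r \<in> {..<2 * r}" if "w \<in> {2 * r..<4 * r}" for w
      using that by auto
    ultimately have "{2 * r..<4 * r} \<subseteq> zf_step ?G {..<2 * r}"
      unfolding zf_step_def by blast
    moreover have "{..<4 * r} = {..<2 * r} \<union> {2 * r..<4 * r}" by auto
    ultimately show "{..<4 * r} \<subseteq> zf_step ?G {..<2 * r}"
      using zf_step_superset[of "{..<2 * r}" ?G] by simp
  qed
  then show "throttling_star ?G \<le> enat (2 * r)"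
    using throttling_star_le[of "{..<2 * r}" ?G 1] assms by auto
  show "enat (2 * r) \<le> throttling_star ?G"
  proof (cases "throttling_star ?G = \<infinity>")
    case False
    then obtain B t where B: "B \<subseteq> pverts ?G" "0 < t" "zf_after ?G B t = pverts ?G"
      and th: "throttling_star ?G = enat (card B * t)"
      by (meson throttling_star_attained)
    have "card B * 1 \<le> card B * t" using B(2) by (intro mult_left_mono) auto
    moreover have "4 * r \<le> card B + card B * t"
      using card_full[OF pair_graph_sharp_graph B(1,3)] by simp
    ultimately have "2 * r \<le> card B * t" by linarith
    then show ?thesis using th by simp
  qed simp
qed

text \<open>In the complement the core becomes the perfect matching \<open>{i, i + r}\<close>. Once
  the pendant vertices and half of the core are filled, each \<open>i\<close> forces
  \<open>i + r\<close>. Core and pendant vertices are nearly joined with \<open>m = 2 * r\<close>,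
  so \<open>4 <= r\<close> yields \<open>8 <= m\<close>.\<close>

lemma throttling_star_complement_sharp_graph:
  assumes "4 \<le> r"
  shows "throttling_star (graph_complement (sharp_graph r)) = enat (3 * r)"
proof (rule antisym)
  let ?H = "graph_complement (sharp_graph r)" and ?B = "{..<r} \<union> {2 * r..<4 * r}"
  note H = pair_graph_complement[OF pair_graph_sharp_graph, of r]
  have "zf_step ?H ?B = {..<4 * r}"
  proof
    show "zf_step ?H ?B \<subseteq> {..<4 * r}"
      using zf_step_subset[OF H, of ?B] by fastforce
    have "{u. (w - r, u) \<in> parcs ?H \<and> u \<notin> ?B} = {w}" if "w \<in> {r..<2 * r}" for w
    proof -
      have "u mod r = u - r" if "r \<le> u" "u < 2 * r" for u
        using that by (simp add: le_mod_geq)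
      then show ?thesis using that by auto
    qed
    moreover have "w - r \<in> ?B" if "w \<in> {r..<2 * r}" for w using that by auto
    ultimately have "{r..<2 * r} \<subseteq> zf_step ?H ?B"
      unfolding zf_step_def by blast
    moreover have "{..<4 * r} = ?B \<union> {r..<2 * r}" by auto
    ultimately show "{..<4 * r} \<subseteq> zf_step ?H ?B"
      using zf_step_superset[of ?B ?H] by (simp only: Un_least)
  qed
  moreover have "card ?B = 3 * r"
    by (subst card_Un_disjoint) auto
  moreover have "?B \<subseteq> {..<4 * r}" by auto
  ultimately show "throttling_star ?H \<le> enat (3 * r)"
    using throttling_star_le[of ?B ?H 1] assms by simp
  have join: "nearly_joined ?H {..<2 * r} {2 * r..<4 * r}"
    unfolding nearly_joined_def
  proof (intro conjI ballI)
    show "\<exists>q. \<forall>y\<in>{2 * r..<4 * r}. y \<noteq> q \<longrightarrow> (x, y) \<in> parcs ?H" if "x \<in> {..<2 * r}" for x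
      using that by (intro exI[of _ "x + 2 * r"]) auto
    show "\<exists>p. \<forall>x\<in>{..<2 * r}. x \<noteq> p \<longrightarrow> (x, y) \<in> parcs ?H" if "y \<in> {2 * r..<4 * r}" for y
      using that by (intro exI[of _ "y - 2 * r"]) auto
  qed
  show "enat (3 * r) \<le> throttling_star ?H"
  proof (cases "throttling_star ?H = \<infinity>")
    case False
    then obtain B t where B: "B \<subseteq> pverts ?H" "0 < t" "zf_after ?H B t = pverts ?H"
      and th: "throttling_star ?H = enat (card B * t)"
      by (meson throttling_star_attained)
    have "3 * card (pverts ?H) \<le> 4 * (card B * t)"
      by (rule nearly_joined_cost(2)[OF H _ _ _ _ _ join B(1,3,2), of "2 * r"]) (use assms in auto)
    then show ?thesis using th by (simp add: mult.commute)
  qed simp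
qed

lemma digraph_iso_card_verts:
  assumes "digraph_iso G H"
  shows "card (verts G) = card (verts H)"
  using assms unfolding digraph_iso_def
  by (auto simp: verts_app_iso card_image pre_digraph.digraph_isomorphism_inj_on_verts)

text \<open>At order \<open>n = 4 * r\<close> the two numbers are \<open>2 * r\<close> and
  \<open>3 * r\<close>; their sum \<open>5 * n / 4\<close> exceeds the bound by exactly
  \<open>2\<close>, the witness for \<open>k\<close>. Different \<open>r\<close> give different
  orders, hence non-isomorphic graphs.\<close>

lemma almost_sharp_connected:
  "almost_sharp
     {G :: nat pair_pre_digraph.
        pair_graph G \<and> card (pverts G) \<ge> 2 \<and> has_edge G \<and> has_edge (graph_complement G) \<and>
        Digraph_Component.connected (with_proj G) \<and>
        Digraph_Component.connected (with_proj (graph_complement G))}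
     throttling_star (\<lambda>n. 5 * real n / 4 - 2)"
  unfolding almost_sharp_def infinitely_many_graphs_def
proof (intro exI[of _ 2] exI[of _ "sharp_graph ` {4..}"] conjI subsetI)
  have inj: "r = r'" if "digraph_iso (with_proj (sharp_graph r)) (with_proj (sharp_graph r'))" for r r'
    using digraph_iso_card_verts[OF that] by simp
  then show "pairwise (\<lambda>G H. \<not> digraph_iso (with_proj G) (with_proj H)) (sharp_graph ` {4..})"
    by (auto simp: pairwise_def)
  have "inj_on sharp_graph {4..}"
    by (rule inj_onI) (metis pverts_sharp_graph card_lessThan mult_cancel1 zero_neq_numeral)
  then show "infinite (sharp_graph ` {4..})"
    by (simp add: finite_image_iff infinite_Ici)
next
  fix G assume "G \<in> sharp_graph ` {4..}"
  then obtain r where r: "4 \<le> r" "G = sharp_graph r" by auto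
  have "(0, 2 * r) \<in> parcs G" "(0, 2 * r + 1) \<in> parcs (graph_complement G)"
    using r by auto
  then have "has_edge G" "has_edge (graph_complement G)"
    unfolding has_edge_def by blast+
  moreover have "throttling_star G + throttling_star (graph_complement G) = enat (5 * r)"
    using r by (simp add: throttling_star_sharp_graph throttling_star_complement_sharp_graph)
  ultimately show "G \<in> {G \<in> {G. pair_graph G \<and> 2 \<le> card (pverts G) \<and> has_edge G \<and>
      has_edge (graph_complement G) \<and> Digraph_Component.connected (with_proj G) \<and>
      Digraph_Component.connected (with_proj (graph_complement G))}.
    let s = ereal_of_enat (throttling_star G + throttling_star (graph_complement G));
        n = card (pverts G)
    in s = ereal (5 * real n / 4 - 2 + real 2) \<or> s = ereal (5 * real n / 4 - 2 - real 2)}"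
    using r
    by (simp add: Let_def pair_graph_sharp_graph connected_sharp_graph
        connected_complement_sharp_graph)
qed simp_all

theorem theorem2p11:
  shows "(\<forall>G :: 'a pair_pre_digraph.
            pair_graph G \<and> card (pverts G) \<ge> 2 \<and> has_edge G \<and> has_edge (graph_complement G) \<longrightarrow>
            ereal (5 * real (card (pverts G)) / 4 - 2)
              \<le> ereal_of_enat (throttling_star G + throttling_star (graph_complement G)))
       \<and> almost_sharp
           {G :: nat pair_pre_digraph.
              pair_graph G \<and> card (pverts G) \<ge> 2 \<and> has_edge G \<and> has_edge (graph_complement G) \<and>
              Digraph_Component.connected (with_proj G) \<and>
              Digraph_Component.connected (with_proj (graph_complement G))}
           throttling_star (\<lambda>n. 5 * real n / 4 - 2)"
  using throttling_star_complement_bound almost_sharp_connected by blast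

end
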